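(* Consider the following decision problem (shape implication w.r.t. constraints under the supported model semantics): given finite sets $\mathcal{C}_1,\mathcal{C}_2$ of $\mathcal{ALCIO}$ SHACL shape constraints and shape names $s_1,s_2$, decide whether for every data graph $\mathcal{G}$ (compatible with both constraint sets) and every node $a$ of $\mathcal{G}$, if $a$ satisfies $s_1$ w.r.t. $\mathcal{C}_1$ under the supported model semantics then $a$ satisfies $s_2$ w.r.t. $\mathcal{C}_2$ under the supported model semantics. This problem is undecidable, and it remains undecidable when $\mathcal{C}_1$ and $\mathcal{C}_2$ are required to be stratified.
   Context: Fix countably infinite, pairwise disjoint sets $N_C$ (concept names), $N_R$ (role names), $N_I$ (individuals), $N_S$ (shape names). Roles are $p$ and $p^-$ for $p\in N_R$, with $(p^-)^-=p$. A data graph $\mathcal{G}$ is a set of atoms $A(a)$ and $p(a,a')$ ($A\in N_C$, $p\in N_R$, $a,a'\in N_I$); here graphs may be finite or countably infinite. $\Delta^{\mathcal{G}}$ is the set of individuals occurring in $\mathcal{G}$, $A^{\mathcal{G}}=\{a\mid A(a)\in\mathcal{G}\}$, $p^{\mathcal{G}}=\{(a,a')\mid p(a,a')\in\mathcal{G}\}$, $(p^-)^{\mathcal{G}}=\{(a',a)\mid (a,a')\in p^{\mathcal{G}}\}$. $\mathcal{ALCIO}$ SHACL shape expressions: $\varphi::= s\mid a\mid A\mid \neg s\mid \varphi\land\varphi\mid\varphi\lor\varphi\mid \forall r.\varphi\mid\exists r.\varphi$ with $s\in N_S$, $a\in N_I$, $A\in N_C$, $r$ a role. A shape constraint is $s\gets\varphi$;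 a constraint set contains at most one constraint with a given head $s$. A shape name is defined in $\mathcal{C}$ if it is the head of a constraint of $\mathcal{C}$. A shape assignment $S$ is a set of literals $s(a)$, $\neg s(a)$ not containing both $s(a)$ and $\neg s(a)$. For a graph $\mathcal{G}$ and assignment $S$ define $\lfloor\cdot\rfloor^{\mathcal{G}}_S$ on shape expressions: $\lfloor s\rfloor=\{a\mid s(a)\in S\}$, $\lfloor\neg s\rfloor=\{a\mid\neg s(a)\in S\}$, $\lfloor a\rfloor=\{a\}$, $\lfloor A\rfloor=A^{\mathcal{G}}$, $\lor$ is union, $\land$ is intersection, $\lfloor\forall r.\varphi\rfloor=\{a\in\Delta^{\mathcal{G}}\mid \forall a'\,((a,a')\in r^{\mathcal{G}}\Rightarrow a'\in\lfloor\varphi\rfloor)\}$, $\lfloor\exists r.\varphi\rfloor=\{a\in\Delta^{\mathcal{G}}\mid\exists a'\,((a,a')\in r^{\mathcal{G}}\text{ and } a'\in\lfloor\varphi\rfloor)\}$. Supported model semantics: a supported model of $\mathcal{C}$ and $\mathcal{G}$ is a shape assignment $S$ that is total (for every shape name $s$ of $\mathcal{C}$ and every $a\in\Delta^{\mathcal{G}}$, $s(a)\in S$ or $\neg s(a)\in S$) and satisfies $\{a\in\Delta^{\mathcal{G}}\mid s(a)\in S\}=\lfloor\varphi\rfloor^{\mathcal{G}}_S$ for every $s\gets\varphi\in\mathcal{C}$. A node $a$ of $\mathcal{G}$ satisfies $s$ w.r.t. $\mathcal{C}$ under this semantics if some supported model $S$ of $\mathcal{C}$ and $\mathcal{G}$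 contains $s(a)$. A graph is compatible with $\mathcal{C}$ if every individual occurring in $\mathcal{C}$ occurs in $\mathcal{G}$. Stratification: $\mathcal{C}$ is stratified if it can be partitioned into $\mathcal{C}_0,\dots,\mathcal{C}_k$ such that for all $0\le i\le k$: (1) if $i<k$ and a shape name $s'$ occurs in the body $\varphi$ of some $s\gets\varphi\in\mathcal{C}_i$, then $s'$ is defined in $\mathcal{C}_0\cup\dots\cup\mathcal{C}_i$; (2) if $\neg s'$ occurs in the body of some constraint in $\mathcal{C}_i$, then $s'$ is defined in $\mathcal{C}_0\cup\dots\cup\mathcal{C}_{i-1}$. *)

theory Defs
  imports Main "HOL-Library.Nat_Bijection" "HOL-Library.Disjoint_Sets"
begin

section \<open>Names, data graphs\<close>

datatype concept_name = CName (cname_index: nat)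
datatype role_name = RName (rname_index: nat)
datatype individual = Indiv (indiv_index: nat)
datatype shape_name = SName (sname_index: nat)

datatype role = Direct role_name | Inverse role_name

datatype atom =
    ConceptAtom concept_name individual
  | RoleAtom role_name individual individual

text \<open>There are only countably many atoms, so every set of atoms is finite or countably infinite.\<close>

type_synonym data_graph = "atom set"

fun atom_individuals :: "atom \<Rightarrow> individual set" where
  "atom_individuals (ConceptAtom A a) = {a}"
| "atom_individuals (RoleAtom p a b) = {a, b}"

definition nodes :: "data_graph \<Rightarrow> individual set" where
  "nodes G = (\<Union>\<alpha>\<in>G. atom_individuals \<alpha>)"

definition concept_ext :: "data_graph \<Rightarrow> concept_name \<Rightarrow> individual set" where
  "concept_ext G A = {a. ConceptAtom A a \<in> G}"

fun role_ext :: "data_graph \<Rightarrow> role \<Rightarrow> (individual \<times> individual) set" where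
  "role_ext G (Direct p) = {(a, b). RoleAtom p a b \<in> G}"
| "role_ext G (Inverse p) = {(b, a). RoleAtom p a b \<in> G}"


section \<open>Shape expressions and constraints\<close>

datatype shape_expr =
    Shape shape_name
  | Nominal individual
  | Concept concept_name
  | NegShape shape_name
  | And shape_expr shape_expr
  | Or shape_expr shape_expr
  | All role shape_expr
  | Ex role shape_expr

fun expr_shapes :: "shape_expr \<Rightarrow> shape_name set" where
  "expr_shapes (Shape s) = {s}"
| "expr_shapes (Nominal a) = {}"
| "expr_shapes (Concept A) = {}"
| "expr_shapes (NegShape s) = {s}"
| "expr_shapes (And \<phi> \<psi>) = expr_shapes \<phi> \<union> expr_shapes \<psi>"
| "expr_shapes (Or \<phi> \<psi>) = expr_shapes \<phi> \<union> expr_shapes \<psi>"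
| "expr_shapes (All r \<phi>) = expr_shapes \<phi>"
| "expr_shapes (Ex r \<phi>) = expr_shapes \<phi>"

fun expr_neg_shapes :: "shape_expr \<Rightarrow> shape_name set" where
  "expr_neg_shapes (Shape s) = {}"
| "expr_neg_shapes (Nominal a) = {}"
| "expr_neg_shapes (Concept A) = {}"
| "expr_neg_shapes (NegShape s) = {s}"
| "expr_neg_shapes (And \<phi> \<psi>) = expr_neg_shapes \<phi> \<union> expr_neg_shapes \<psi>"
| "expr_neg_shapes (Or \<phi> \<psi>) = expr_neg_shapes \<phi> \<union> expr_neg_shapes \<psi>"
| "expr_neg_shapes (All r \<phi>) = expr_neg_shapes \<phi>"
| "expr_neg_shapes (Ex r \<phi>) = expr_neg_shapes \<phi>"

fun expr_individuals :: "shape_expr \<Rightarrow> individual set" where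
  "expr_individuals (Shape s) = {}"
| "expr_individuals (Nominal a) = {a}"
| "expr_individuals (Concept A) = {}"
| "expr_individuals (NegShape s) = {}"
| "expr_individuals (And \<phi> \<psi>) = expr_individuals \<phi> \<union> expr_individuals \<psi>"
| "expr_individuals (Or \<phi> \<psi>) = expr_individuals \<phi> \<union> expr_individuals \<psi>"
| "expr_individuals (All r \<phi>) = expr_individuals \<phi>"
| "expr_individuals (Ex r \<phi>) = expr_individuals \<phi>"

text \<open>The pair \<open>(s, \<phi>)\<close> is the constraint \<open>s \<leftarrow> \<phi>\<close>. The condition
  \<^const>\<open>single_valued\<close> below says that no two constraints share their head, and
  \<^const>\<open>Domain\<close> yields the shape names defined by a set of constraints.\<close>

type_synonym shape_constraint = "shape_name \<times> shape_expr"

definition constraint_set :: "shape_constraint set \<Rightarrow> bool" where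
  "constraint_set C \<longleftrightarrow> finite C \<and> single_valued C"

definition shape_names :: "shape_constraint set \<Rightarrow> shape_name set" where
  "shape_names C = (\<Union>(s, \<phi>)\<in>C. insert s (expr_shapes \<phi>))"

definition constraint_individuals :: "shape_constraint set \<Rightarrow> individual set" where
  "constraint_individuals C = (\<Union>(s, \<phi>)\<in>C. expr_individuals \<phi>)"

definition compatible :: "data_graph \<Rightarrow> shape_constraint set \<Rightarrow> bool" where
  "compatible G C \<longleftrightarrow> constraint_individuals C \<subseteq> nodes G"

definition stratified :: "shape_constraint set \<Rightarrow> bool" where
  "stratified C \<longleftrightarrow>
    (\<exists>k (P :: nat \<Rightarrow> shape_constraint set).
      C = (\<Union>i\<le>k. P i) \<and> disjoint_family_on P {..k} \<and>
      (\<forall>i\<le>k. \<forall>(s, \<phi>)\<in>P i.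
         (i < k \<longrightarrow> expr_shapes \<phi> \<subseteq> Domain (\<Union>j\<le>i. P j)) \<and>
         expr_neg_shapes \<phi> \<subseteq> Domain (\<Union>j<i. P j)))"


section \<open>Supported model semantics\<close>

datatype shape_literal =
    PosLit shape_name individual
  | NegLit shape_name individual

definition shape_assignment :: "shape_literal set \<Rightarrow> bool" where
  "shape_assignment S \<longleftrightarrow> (\<forall>s a. \<not> (PosLit s a \<in> S \<and> NegLit s a \<in> S))"

fun shape_eval :: "data_graph \<Rightarrow> shape_literal set \<Rightarrow> shape_expr \<Rightarrow> individual set" where
  "shape_eval G S (Shape s) = {a. PosLit s a \<in> S}"
| "shape_eval G S (Nominal a) = {a}"
| "shape_eval G S (Concept A) = concept_ext G A"
| "shape_eval G S (NegShape s) = {a. NegLit s a \<in> S}"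
| "shape_eval G S (And \<phi> \<psi>) = shape_eval G S \<phi> \<inter> shape_eval G S \<psi>"
| "shape_eval G S (Or \<phi> \<psi>) = shape_eval G S \<phi> \<union> shape_eval G S \<psi>"
| "shape_eval G S (All r \<phi>) =
     {a \<in> nodes G. \<forall>b. (a, b) \<in> role_ext G r \<longrightarrow> b \<in> shape_eval G S \<phi>}"
| "shape_eval G S (Ex r \<phi>) =
     {a \<in> nodes G. \<exists>b. (a, b) \<in> role_ext G r \<and> b \<in> shape_eval G S \<phi>}"

definition supported_model ::
  "shape_constraint set \<Rightarrow> data_graph \<Rightarrow> shape_literal set \<Rightarrow> bool" where
  "supported_model C G S \<longleftrightarrow>
    shape_assignment S \<and>
    (\<forall>s\<in>shape_names C. \<forall>a\<in>nodes G. PosLit s a \<in> S \<or> NegLit s a \<in> S) \<and>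
    (\<forall>(s, \<phi>)\<in>C. {a \<in> nodes G. PosLit s a \<in> S} = shape_eval G S \<phi>)"

definition satisfies_shape ::
  "shape_constraint set \<Rightarrow> data_graph \<Rightarrow> individual \<Rightarrow> shape_name \<Rightarrow> bool" where
  "satisfies_shape C G a s \<longleftrightarrow> (\<exists>S. supported_model C G S \<and> PosLit s a \<in> S)"


section \<open>The shape implication problem\<close>

type_synonym implication_instance =
  "shape_constraint set \<times> shape_constraint set \<times> shape_name \<times> shape_name"

fun shape_implication :: "implication_instance \<Rightarrow> bool" where
  "shape_implication (C1, C2, s1, s2) \<longleftrightarrow>
    (\<forall>G. compatible G C1 \<longrightarrow> compatible G C2 \<longrightarrow>
      (\<forall>a\<in>nodes G. satisfies_shape C1 G a s1 \<longrightarrow> satisfies_shape C2 G a s2))"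

definition implication_instances :: "implication_instance set" where
  "implication_instances =
    {(C1, C2, s1, s2). constraint_set C1 \<and> constraint_set C2}"

definition stratified_implication_instances :: "implication_instance set" where
  "stratified_implication_instances =
    {(C1, C2, s1, s2). constraint_set C1 \<and> constraint_set C2 \<and> stratified C1 \<and> stratified C2}"


section \<open>Encoding instances as natural numbers\<close>

fun role_code :: "role \<Rightarrow> nat" where
  "role_code (Direct p) = prod_encode (0, rname_index p)"
| "role_code (Inverse p) = prod_encode (1, rname_index p)"

fun expr_code :: "shape_expr \<Rightarrow> nat" where
  "expr_code (Shape s) = prod_encode (0, sname_index s)"
| "expr_code (Nominal a) = prod_encode (1, indiv_index a)"
| "expr_code (Concept A) = prod_encode (2, cname_index A)"
| "expr_code (NegShape s) = prod_encode (3, sname_index s)"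
| "expr_code (And \<phi> \<psi>) = prod_encode (4, prod_encode (expr_code \<phi>, expr_code \<psi>))"
| "expr_code (Or \<phi> \<psi>) = prod_encode (5, prod_encode (expr_code \<phi>, expr_code \<psi>))"
| "expr_code (All r \<phi>) = prod_encode (6, prod_encode (role_code r, expr_code \<phi>))"
| "expr_code (Ex r \<phi>) = prod_encode (7, prod_encode (role_code r, expr_code \<phi>))"

definition constraint_code :: "shape_constraint \<Rightarrow> nat" where
  "constraint_code c = prod_encode (sname_index (fst c), expr_code (snd c))"

text \<open>A finite set of constraints is represented by the canonical index
  \<open>\<Sum>c\<in>C. 2 ^ constraint_code c\<close>, which determines the set and from which its elements can
  be listed effectively.\<close>

definition constraint_set_code :: "shape_constraint set \<Rightarrow> nat" where
  "constraint_set_code C = set_encode (constraint_code ` C)"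

fun instance_code :: "implication_instance \<Rightarrow> nat" where
  "instance_code (C1, C2, s1, s2) =
    prod_encode (prod_encode (constraint_set_code C1, constraint_set_code C2),
                 prod_encode (sname_index s1, sname_index s2))"

text \<open>The encoding loses no information, so that different instances are different inputs.\<close>

lemma role_code_inject: "role_code r = role_code r' \<longleftrightarrow> r = r'"
  by (cases r; cases r') (auto simp: prod_encode_eq role_name.expand)

lemma expr_code_inject: "expr_code \<phi> = expr_code \<psi> \<longleftrightarrow> \<phi> = \<psi>"
proof (induction \<phi> arbitrary: \<psi>)
  case (Shape s) then show ?case
    by (cases \<psi>) (auto simp: prod_encode_eq shape_name.expand)
next
  case (Nominal a) then show ?case
    by (cases \<psi>) (auto simp: prod_encode_eq individual.expand)
next
  case (Concept A) then show ?case
    by (cases \<psi>) (auto simp: prod_encode_eq concept_name.expand)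
next
  case (NegShape s) then show ?case
    by (cases \<psi>) (auto simp: prod_encode_eq shape_name.expand)
qed (case_tac [!] \<psi>, auto simp: prod_encode_eq role_code_inject)

lemma constraint_code_inject: "constraint_code c = constraint_code d \<longleftrightarrow> c = d"
  by (auto simp: constraint_code_def prod_encode_eq expr_code_inject prod_eq_iff shape_name.expand)

lemma constraint_set_code_inject:
  assumes "finite C" "finite D"
  shows "constraint_set_code C = constraint_set_code D \<longleftrightarrow> C = D"
  using assms inj_image_eq_iff[of constraint_code C D]
  by (simp add: constraint_set_code_def set_encode_eq inj_def constraint_code_inject)

lemma instance_code_inj: "inj_on instance_code implication_instances"
  by (auto simp: inj_on_def implication_instances_def constraint_set_def prod_encode_eq
      constraint_set_code_inject shape_name.expand)


section \<open>Partial recursive functions and decidability\<close>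

datatype recf =
    Zero
  | Succ
  | Proj nat
  | Comp recf "recf list"
  | PrimRec recf recf
  | Mu recf

text \<open>\<open>rec_eval f xs y\<close> says that \<open>f\<close> is defined on the arguments \<open>xs\<close> with value \<open>y\<close>.
  Arities are not part of the syntax: for each number of arguments, an expression denotes one
  partial recursive function of that many arguments (nowhere defined if the arity does not fit),
  and every partial recursive function is obtained in this way.\<close>

inductive rec_eval :: "recf \<Rightarrow> nat list \<Rightarrow> nat \<Rightarrow> bool" where
  zero: "rec_eval Zero xs 0"
| succ: "rec_eval Succ [x] (Suc x)"
| proj: "i < length xs \<Longrightarrow> rec_eval (Proj i) xs (xs ! i)"
| comp: "list_all2 (\<lambda>g y. rec_eval g xs y) gs ys \<Longrightarrow> rec_eval f ys z \<Longrightarrow>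
    rec_eval (Comp f gs) xs z"
| primrec_0: "rec_eval f xs y \<Longrightarrow> rec_eval (PrimRec f g) (0 # xs) y"
| primrec_Suc: "rec_eval (PrimRec f g) (n # xs) y \<Longrightarrow> rec_eval g (n # y # xs) z \<Longrightarrow>
    rec_eval (PrimRec f g) (Suc n # xs) z"
| mu: "rec_eval f (n # xs) 0 \<Longrightarrow> \<forall>m<n. \<exists>k. rec_eval f (m # xs) (Suc k) \<Longrightarrow>
    rec_eval (Mu f) xs n"

inductive_cases rec_eval_ZeroE: "rec_eval Zero xs y"
inductive_cases rec_eval_SuccE: "rec_eval Succ xs y"
inductive_cases rec_eval_ProjE: "rec_eval (Proj i) xs y"
inductive_cases rec_eval_CompE: "rec_eval (Comp f gs) xs y"
inductive_cases rec_eval_PrimRec0E: "rec_eval (PrimRec f g) (0 # xs) y"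
inductive_cases rec_eval_PrimRecSucE: "rec_eval (PrimRec f g) (Suc n # xs) y"
inductive_cases rec_eval_MuE: "rec_eval (Mu f) xs y"

lemma rec_eval_unique: "rec_eval f xs y \<Longrightarrow> rec_eval f xs z \<Longrightarrow> y = z"
proof (induction arbitrary: z rule: rec_eval.induct)
  case (comp xs gs ys f z')
  from comp.prems obtain ys' where
    ys': "list_all2 (\<lambda>g y. rec_eval g xs y) gs ys'" "rec_eval f ys' z"
    by (rule rec_eval_CompE)
  have "ys = ys'"
    using comp.IH(1) ys'(1) by (auto simp: list_all2_conv_all_nth intro!: nth_equalityI)
  with comp.IH(2) ys'(2) show ?case by simp
next
  case (mu f n xs)
  from mu.prems have z: "rec_eval f (z # xs) 0" "\<forall>m<z. \<exists>k. rec_eval f (m # xs) (Suc k)"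
    by (auto elim: rec_eval_MuE)
  have "\<not> n < z" using mu.IH(1) z(2) by fastforce
  moreover have "\<not> z < n" using mu.IH(2) z(1) by fastforce
  ultimately show ?case by simp
qed (blast elim: rec_eval_ZeroE rec_eval_SuccE rec_eval_ProjE
      rec_eval_PrimRec0E rec_eval_PrimRecSucE)+

text \<open>A decision problem is given by its set \<open>D\<close> of instances, encoded by \<open>code\<close>, and the
  property \<open>P\<close> to be decided. A decision procedure only has to be correct, and only has to
  terminate, on codes of members of \<open>D\<close>, so undecidability in this sense does not depend on whether
  membership in \<open>D\<close> can be checked.\<close>

definition decidable_problem :: "('a \<Rightarrow> nat) \<Rightarrow> 'a set \<Rightarrow> ('a \<Rightarrow> bool) \<Rightarrow> bool" where
  "decidable_problem code D P \<longleftrightarrow>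
    (\<exists>f. \<forall>x\<in>D. rec_eval f [code x] (if P x then 1 else 0))"

end

theory Submission
  imports Defs "HOL-Library.Countable"
begin

text \<open>
  The first constraint set is empty, so an implication fails iff the second set has, on some graph
  \<open>G\<close> and node \<open>a\<close>, no supported model containing \<open>s\<^sub>2(a)\<close>. A shape with the constraint
  \<open>s \<leftarrow> s\<close> is a freely chosen set of nodes, hence failure is a universal monadic second-order
  property of \<open>(G, a)\<close>, and it can say that \<open>G\<close> is closed under rules \<open>b \<rightarrow> h\<close> between
  positive modal formulas. Such rules express that \<open>G\<close> contains the evaluation relation
  of a given partial recursive function \<open>g\<close>, where nodes stand for numbers and lists of numbers.
  One further clause says that some node for the argument \<open>n\<close> has no outgoing \<open>g\<close>-edge. The
  implication therefore holds iff \<open>g\<close> is defined at \<open>n\<close>. No universal machine is needed: if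
  \<open>f\<close> decided implication, let \<open>g\<close> on \<open>n\<close> compute the code of the instance whose
  constraints for everything but the input have code \<open>n\<close>, and halt iff \<open>f\<close> rejects it; then
  apply \<open>g\<close> to the code of its own constraints.
\<close>

section \<open>Rules for the evaluation of recursive functions\<close>

instance recf :: countable
  by countable_datatype

text \<open>At a node for an argument list, \<open>Eval f\<close> leads to the value,
  \<open>Args gs\<close> to the list of values of \<open>gs\<close>, \<open>Pred\<close> from
  \<open>Suc n # xs\<close> to \<open>n # xs\<close>, \<open>Step\<close> on to
  \<open>n # y # xs\<close> with \<open>y\<close> the recursive value, and \<open>Search f\<close>
  from \<open>xs\<close> to \<open>n # xs\<close> while \<open>f\<close> is positive below
  \<open>n\<close>. \<open>Hub\<close> leads from a root to the nodes at which rules apply.\<close>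

datatype edge =
    Hub
  | SuccOf
  | Head
  | Tail
  | Eval recf
  | Args "recf list"
  | Pred
  | Step recf
  | Search recf

instance edge :: countable
  by countable_datatype

text \<open>Edge labels carry whole programs; countability gives each of them its own role
  name.\<close>

definition edge_name :: "edge \<Rightarrow> role_name" where
  "edge_name k = RName (to_nat k)"

lemma edge_name_eq [simp]: "edge_name k = edge_name k' \<longleftrightarrow> k = k'"
  by (simp add: edge_name_def)

datatype label = Origin | Input | Root | LX | LY | LZ

fun label_name :: "label \<Rightarrow> shape_name" where
  "label_name Origin = SName 0"
| "label_name Input = SName 1"
| "label_name Root = SName 2"
| "label_name LX = SName 3"
| "label_name LY = SName 4"
| "label_name LZ = SName 5"

abbreviation goal_name :: shape_name where
  "goal_name \<equiv> SName 6"

datatype query = Lab label | Conj query query | Dia edge query | DiaInv edge query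

fun holds :: "data_graph \<Rightarrow> (label \<Rightarrow> individual set) \<Rightarrow> query \<Rightarrow> individual \<Rightarrow> bool" where
  "holds G V (Lab l) u \<longleftrightarrow> u \<in> V l"
| "holds G V (Conj p q) u \<longleftrightarrow> holds G V p u \<and> holds G V q u"
| "holds G V (Dia k q) u \<longleftrightarrow> (\<exists>v. RoleAtom (edge_name k) u v \<in> G \<and> holds G V q v)"
| "holds G V (DiaInv k q) u \<longleftrightarrow> (\<exists>v. RoleAtom (edge_name k) v u \<in> G \<and> holds G V q v)"

fun pos_expr :: "query \<Rightarrow> shape_expr" where
  "pos_expr (Lab l) = Shape (label_name l)"
| "pos_expr (Conj p q) = And (pos_expr p) (pos_expr q)"
| "pos_expr (Dia k q) = Ex (Direct (edge_name k)) (pos_expr q)"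
| "pos_expr (DiaInv k q) = Ex (Inverse (edge_name k)) (pos_expr q)"

text \<open>The negation of \<open>pos_expr\<close>, pushed down to shape names, where alone the
  syntax permits it.\<close>

fun neg_expr :: "query \<Rightarrow> shape_expr" where
  "neg_expr (Lab l) = NegShape (label_name l)"
| "neg_expr (Conj p q) = Or (neg_expr p) (neg_expr q)"
| "neg_expr (Dia k q) = All (Direct (edge_name k)) (neg_expr q)"
| "neg_expr (DiaInv k q) = All (Inverse (edge_name k)) (neg_expr q)"

text \<open>Rules apply only at \<open>Hub\<close> successors of the root, so heads that demand a
  list node must demand this edge as well. The root is an arbitrary node and has no nominal; the
  label \<open>Root\<close> stands in for it.\<close>

abbreviation listed :: query where
  "listed \<equiv> DiaInv Hub (Lab Root)"

abbreviation nil_query :: query where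
  "nil_query \<equiv> Conj listed (Lab Origin)"

abbreviation cons_query :: "query \<Rightarrow> query \<Rightarrow> query" where
  "cons_query p q \<equiv> Conj listed (Conj (Dia Head p) (Dia Tail q))"

text \<open>A pair \<open>(b, h)\<close> stands for the requirement that every node satisfying \<open>b\<close> satisfies
  \<open>h\<close>, whatever sets of nodes \<open>LX\<close>, \<open>LY\<close> and \<open>LZ\<close> denote. Instantiating the labels by
  singletons turns it into an existential Horn rule about edges.\<close>

type_synonym rule = "query \<times> query"

text \<open>Modal formulas cannot refer back to the current node. A body \<open>Lab LX\<close>, read
  with the singleton of that node, names it, so that the head can use it again, for example as the
  tail of a new list in the \<open>Mu\<close> rules.\<close>

fun rules :: "recf \<Rightarrow> rule list" and arg_rules :: "recf list \<Rightarrow> rule list" where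
  "rules Zero = [(Lab LX, Dia (Eval Zero) (Lab Origin))]"
| "rules Succ =
    [(Conj (Dia Head (Lab LX)) (Dia Tail (Lab Origin)), Dia (Eval Succ) (DiaInv SuccOf (Lab LX)))]"
| "rules (Proj i) = [((Dia Tail ^^ i) (Dia Head (Lab LX)), Dia (Eval (Proj i)) (Lab LX))]"
| "rules (Comp f gs) =
    (Dia (Args gs) (Dia (Eval f) (Lab LX)), Dia (Eval (Comp f gs)) (Lab LX)) #
    rules f @ arg_rules gs"
| "rules (PrimRec f g) =
    [(Conj (Dia Head (Lab Origin)) (Dia Tail (Dia (Eval f) (Lab LX))),
      Dia (Eval (PrimRec f g)) (Lab LX)),
     (Conj (Dia Head (DiaInv SuccOf (Lab LX))) (Dia Tail (Lab LY)),
      Dia Pred (cons_query (Lab LX) (Lab LY))),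
     (Conj (Dia Head (DiaInv SuccOf (Lab LX)))
        (Conj (Dia Tail (Lab LY)) (Dia Pred (Dia (Eval (PrimRec f g)) (Lab LZ)))),
      Dia (Step (PrimRec f g)) (cons_query (Lab LX) (cons_query (Lab LZ) (Lab LY)))),
     (Dia (Step (PrimRec f g)) (Dia (Eval g) (Lab LX)), Dia (Eval (PrimRec f g)) (Lab LX))] @
    rules f @ rules g"
| "rules (Mu f) =
    [(Lab LX, Dia (Search f) (cons_query (Lab Origin) (Lab LX))),
     (Conj (Lab LX)
        (Dia (Search f) (Conj (Dia Head (Lab LY)) (Dia (Eval f) (DiaInv SuccOf (Lab LZ))))),
      Dia (Search f) (cons_query (DiaInv SuccOf (Lab LY)) (Lab LX))),
     (Dia (Search f) (Conj (Dia Head (Lab LX)) (Dia (Eval f) (Lab Origin))),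
      Dia (Eval (Mu f)) (Lab LX))] @
    rules f"
| "arg_rules [] = [(Lab LX, Dia (Args []) nil_query)]"
| "arg_rules (g # gs) =
    (Conj (Dia (Eval g) (Lab LX)) (Dia (Args gs) (Lab LY)),
     Dia (Args (g # gs)) (cons_query (Lab LX) (Lab LY))) #
    rules g @ arg_rules gs"

section \<open>Graphs closed under the rules contain the evaluation relation\<close>

abbreviation origin :: individual where
  "origin \<equiv> Indiv 0"

text \<open>In an arbitrary graph a number may be represented by several nodes or by none, hence a
  relation; only zero is pinned down, by a nominal.\<close>

fun num_node :: "data_graph \<Rightarrow> nat \<Rightarrow> individual \<Rightarrow> bool" where
  "num_node G 0 v \<longleftrightarrow> v = origin"
| "num_node G (Suc n) v \<longleftrightarrow> (\<exists>w. RoleAtom (edge_name SuccOf) w v \<in> G \<and> num_node G n w)"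

fun list_node :: "data_graph \<Rightarrow> individual \<Rightarrow> nat list \<Rightarrow> individual \<Rightarrow> bool" where
  "list_node G a [] u \<longleftrightarrow> RoleAtom (edge_name Hub) a u \<in> G \<and> u = origin"
| "list_node G a (x # xs) u \<longleftrightarrow> RoleAtom (edge_name Hub) a u \<in> G \<and>
    (\<exists>v w. RoleAtom (edge_name Head) u v \<in> G \<and> RoleAtom (edge_name Tail) u w \<in> G \<and>
      num_node G x v \<and> list_node G a xs w)"

definition valid :: "data_graph \<Rightarrow> individual set \<Rightarrow> individual \<Rightarrow> rule \<Rightarrow> bool" where
  "valid G I a r \<longleftrightarrow> (\<forall>V u. V Origin = {origin} \<longrightarrow> V Input = I \<longrightarrow> a \<in> V Root \<longrightarrow>
    RoleAtom (edge_name Hub) a u \<in> G \<longrightarrow> holds G V (fst r) u \<longrightarrow> holds G V (snd r) u)"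

fun val :: "individual set \<Rightarrow> individual \<Rightarrow> individual set \<Rightarrow> individual set \<Rightarrow> individual set \<Rightarrow>
    label \<Rightarrow> individual set" where
  "val I a X Y Z Origin = {origin}"
| "val I a X Y Z Input = I"
| "val I a X Y Z Root = {a}"
| "val I a X Y Z LX = X"
| "val I a X Y Z LY = Y"
| "val I a X Y Z LZ = Z"

lemma validD:
  assumes "valid G I a (b, h)" "RoleAtom (edge_name Hub) a u \<in> G" "holds G (val I a X Y Z) b u"
  shows "holds G (val I a X Y Z) h u"
  using assms by (simp add: valid_def)

lemma list_node_hub: "list_node G a xs u \<Longrightarrow> RoleAtom (edge_name Hub) a u \<in> G"
  by (cases xs) auto

lemma holds_proj:
  "list_node G a xs u \<Longrightarrow> i < length xs \<Longrightarrow>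
    \<exists>v. num_node G (xs ! i) v \<and> holds G (val I a {v} Y Z) ((Dia Tail ^^ i) (Dia Head (Lab LX))) u"
proof (induction i arbitrary: xs u)
  case 0
  then show ?case by (cases xs) auto
next
  case (Suc i)
  then obtain x xs' where "xs = x # xs'" by (cases xs) auto
  with Suc show ?case by (fastforce)
qed

text \<open>The first assumption is what rule induction on \<open>rec_eval\<close> yields for a
  composition at a fixed node \<open>u\<close>; the list of values is then built from its end by the
  \<open>arg_rules\<close>.\<close>

lemma args_edge:
  assumes "list_all2 (\<lambda>g y. (\<forall>r\<in>set (rules g). valid G I a r) \<longrightarrow>
      (\<exists>v. RoleAtom (edge_name (Eval g)) u v \<in> G \<and> num_node G y v)) gs ys"
    and "\<forall>r\<in>set (arg_rules gs). valid G I a r" and "RoleAtom (edge_name Hub) a u \<in> G"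
  shows "\<exists>w. RoleAtom (edge_name (Args gs)) u w \<in> G \<and> list_node G a ys w"
  using assms
proof (induction rule: list_all2_induct)
  case Nil
  then have "valid G I a (Lab LX, Dia (Args []) nil_query)" by simp
  from validD[OF this Nil.prems(2), of "{u}"] show ?case by auto
next
  case (Cons g gs y ys)
  from Cons.IH Cons.prems obtain w where
    w: "RoleAtom (edge_name (Args gs)) u w \<in> G" "list_node G a ys w" by auto
  from Cons.hyps(1) Cons.prems obtain v where
    v: "RoleAtom (edge_name (Eval g)) u v \<in> G" "num_node G y v" by auto
  have "valid G I a (Conj (Dia (Eval g) (Lab LX)) (Dia (Args gs) (Lab LY)),
     Dia (Args (g # gs)) (cons_query (Lab LX) (Lab LY)))" using Cons.prems by simp
  from validD[OF this Cons.prems(2), of "{v}" "{w}"] v w show ?case by auto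
qed

text \<open>The derivation of \<open>rec_eval\<close> is replayed by rules with singleton labels.
  Only the existence of a correct edge is claimed, since \<open>G\<close> may also contain spurious
  ones.\<close>

lemma eval_edge:
  assumes "rec_eval f xs y" "\<forall>r\<in>set (rules f). valid G I a r" "list_node G a xs u"
  shows "\<exists>v. RoleAtom (edge_name (Eval f)) u v \<in> G \<and> num_node G y v"
  using assms
proof (induction arbitrary: u rule: rec_eval.induct)
  case (zero xs)
  then have "valid G I a (Lab LX, Dia (Eval Zero) (Lab Origin))" by simp
  from validD[OF this list_node_hub[OF zero(2)], of "{u}"] show ?case by auto
next
  case (succ x)
  then obtain v where "RoleAtom (edge_name Head) u v \<in> G" "num_node G x v"
    "RoleAtom (edge_name Tail) u origin \<in> G" by auto
  moreover have "valid G I a (Conj (Dia Head (Lab LX)) (Dia Tail (Lab Origin)),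
      Dia (Eval Succ) (DiaInv SuccOf (Lab LX)))"
    using succ by simp
  note validD[OF this list_node_hub[OF succ(2)], of "{v}"]
  ultimately show ?case by auto
next
  case (proj i xs)
  then obtain v where v: "num_node G (xs ! i) v"
    "holds G (val I a {v} {} {}) ((Dia Tail ^^ i) (Dia Head (Lab LX))) u"
    using holds_proj by metis
  have "valid G I a ((Dia Tail ^^ i) (Dia Head (Lab LX)), Dia (Eval (Proj i)) (Lab LX))"
    using proj by simp
  from validD[OF this list_node_hub v(2)] v(1) proj show ?case by auto
next
  case (comp xs gs ys f z)
  have hub: "RoleAtom (edge_name Hub) a u \<in> G" using comp.prems by (rule_tac list_node_hub)
  have "\<exists>w. RoleAtom (edge_name (Args gs)) u w \<in> G \<and> list_node G a ys w"
    using comp.prems hub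
    by (intro args_edge list_all2_mono[OF comp.IH(1)]) auto
  then obtain w where w: "RoleAtom (edge_name (Args gs)) u w \<in> G" "list_node G a ys w" by auto
  with comp obtain v where v: "RoleAtom (edge_name (Eval f)) w v \<in> G" "num_node G z v"
    by fastforce
  have "valid G I a (Dia (Args gs) (Dia (Eval f) (Lab LX)), Dia (Eval (Comp f gs)) (Lab LX))"
    using comp.prems by simp
  from validD[OF this hub, of "{v}"] w v show ?case by auto
next
  case (primrec_0 f xs y g)
  then obtain w where w: "RoleAtom (edge_name Head) u origin \<in> G"
    "RoleAtom (edge_name Tail) u w \<in> G" "list_node G a xs w" by auto
  with primrec_0 obtain v where v: "RoleAtom (edge_name (Eval f)) w v \<in> G" "num_node G y v"
    by fastforce
  have "valid G I a (Conj (Dia Head (Lab Origin)) (Dia Tail (Dia (Eval f) (Lab LX))),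
      Dia (Eval (PrimRec f g)) (Lab LX))" using primrec_0.prems by simp
  from validD[OF this list_node_hub[OF primrec_0.prems(2)], of "{v}"] w v show ?case by auto
next
  case (primrec_Suc f g n xs y z)
  let ?p = "PrimRec f g"
  note hub = list_node_hub[OF primrec_Suc.prems(2)]
  from primrec_Suc.prems obtain m v w where u: "RoleAtom (edge_name Head) u m \<in> G"
    "RoleAtom (edge_name SuccOf) v m \<in> G" "num_node G n v"
    "RoleAtom (edge_name Tail) u w \<in> G" "list_node G a xs w" by auto
  have "valid G I a (Conj (Dia Head (DiaInv SuccOf (Lab LX))) (Dia Tail (Lab LY)),
      Dia Pred (cons_query (Lab LX) (Lab LY)))" using primrec_Suc.prems by simp
  \<comment> \<open>The singletons force the new list to have the very nodes \<open>v\<close> and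
    \<open>w\<close> as head and tail, so it represents \<open>n # xs\<close>.\<close>
  from validD[OF this hub, of "{v}" "{w}"] u obtain u' where
    u': "RoleAtom (edge_name Pred) u u' \<in> G" "list_node G a (n # xs) u'" by auto
  from primrec_Suc.IH(1)[OF primrec_Suc.prems(1) u'(2)] obtain y' where
    y': "RoleAtom (edge_name (Eval ?p)) u' y' \<in> G" "num_node G y y'" by auto
  have "holds G (val I a {v} {w} {y'}) (Conj (Dia Head (DiaInv SuccOf (Lab LX)))
      (Conj (Dia Tail (Lab LY)) (Dia Pred (Dia (Eval ?p) (Lab LZ))))) u"
    using u(1,2,4) u'(1) y'(1) by auto
  moreover have "valid G I a (Conj (Dia Head (DiaInv SuccOf (Lab LX)))
        (Conj (Dia Tail (Lab LY)) (Dia Pred (Dia (Eval ?p) (Lab LZ)))),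
      Dia (Step ?p) (cons_query (Lab LX) (cons_query (Lab LZ) (Lab LY))))"
    using primrec_Suc.prems by simp
  ultimately have "holds G (val I a {v} {w} {y'})
      (Dia (Step ?p) (cons_query (Lab LX) (cons_query (Lab LZ) (Lab LY)))) u"
    using validD hub by blast
  then obtain u'' t where u'': "RoleAtom (edge_name (Step ?p)) u u'' \<in> G"
    and "RoleAtom (edge_name Hub) a u'' \<in> G" "RoleAtom (edge_name Head) u'' v \<in> G"
      "RoleAtom (edge_name Tail) u'' t \<in> G"
    and "RoleAtom (edge_name Hub) a t \<in> G" "RoleAtom (edge_name Head) t y' \<in> G"
      "RoleAtom (edge_name Tail) t w \<in> G"
    by auto
  with u(3,5) y'(2) have "list_node G a (n # y # xs) u''"
    unfolding list_node.simps by blast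
  moreover have "\<forall>r\<in>set (rules g). valid G I a r" using primrec_Suc.prems by simp
  ultimately obtain z' where
    z': "RoleAtom (edge_name (Eval g)) u'' z' \<in> G" "num_node G z z'"
    using primrec_Suc.IH(2) by blast
  have "valid G I a (Dia (Step ?p) (Dia (Eval g) (Lab LX)), Dia (Eval ?p) (Lab LX))"
    using primrec_Suc.prems by simp
  from validD[OF this hub, of "{z'}"] u'' z' show ?case by auto
next
  case (mu f n xs)
  note hub = list_node_hub[OF mu.prems(2)]
  have valid_f: "\<forall>r\<in>set (rules f). valid G I a r" using mu.prems by simp
  have start: "valid G I a (Lab LX, Dia (Search f) (cons_query (Lab Origin) (Lab LX)))"
    and step: "valid G I a (Conj (Lab LX)
        (Dia (Search f) (Conj (Dia Head (Lab LY)) (Dia (Eval f) (DiaInv SuccOf (Lab LZ))))),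
      Dia (Search f) (cons_query (DiaInv SuccOf (Lab LY)) (Lab LX)))"
    and stop: "valid G I a (Dia (Search f) (Conj (Dia Head (Lab LX)) (Dia (Eval f) (Lab Origin))),
      Dia (Eval (Mu f)) (Lab LX))"
    using mu.prems by simp_all
  \<comment> \<open>The search reaches every candidate up to \<open>n\<close>, since a positive
    value at \<open>m\<close> lets it pass on to \<open>Suc m\<close>.\<close>
  have "\<exists>w. RoleAtom (edge_name (Search f)) u w \<in> G \<and> list_node G a (m # xs) w" if "m \<le> n" for m
    using that
  proof (induction m)
    case 0
    from validD[OF start hub, of "{u}"] mu.prems show ?case by auto
  next
    case (Suc m)
    then obtain w v where w: "RoleAtom (edge_name (Search f)) u w \<in> G" "list_node G a (m # xs) w"
      and v: "RoleAtom (edge_name Head) w v \<in> G" "num_node G m v" by auto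
    from Suc.prems mu.IH(2) obtain k where
      "\<And>u. list_node G a (m # xs) u \<Longrightarrow>
        \<exists>v. RoleAtom (edge_name (Eval f)) u v \<in> G \<and> num_node G (Suc k) v"
      using valid_f by (metis Suc_le_lessD)
    with w obtain z where "RoleAtom (edge_name (Eval f)) w z \<in> G" "num_node G (Suc k) z"
      by blast
    \<comment> \<open>With \<open>UNIV\<close> for \<open>LZ\<close> the rule asks only that the
      value of \<open>f\<close> have some predecessor, that is, be positive.\<close>
    with validD[OF step hub, of "{u}" "{v}" UNIV] w v mu.prems show ?case by auto
  qed
  then obtain w v where w: "RoleAtom (edge_name (Search f)) u w \<in> G" "list_node G a (n # xs) w"
    and v: "RoleAtom (edge_name Head) w v \<in> G" "num_node G n v" by fastforce
  from mu.IH(1) valid_f w(2) have "RoleAtom (edge_name (Eval f)) w origin \<in> G" by fastforce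
  with validD[OF stop hub, of "{v}"] w v show ?case by auto
qed

section \<open>The standard graph\<close>

text \<open>The node \<open>Indiv i\<close> stands for the number \<open>i\<close> and for the list with code \<open>i\<close>; in
  particular \<open>Indiv 0\<close> is both zero and the empty list.\<close>

fun std_edge :: "edge \<Rightarrow> nat \<Rightarrow> nat \<Rightarrow> bool" where
  "std_edge Hub i j \<longleftrightarrow> True"
| "std_edge SuccOf i j \<longleftrightarrow> j = Suc i"
| "std_edge Head i j \<longleftrightarrow> (\<exists>xs. list_decode i = j # xs)"
| "std_edge Tail i j \<longleftrightarrow> (\<exists>x. list_decode i = x # list_decode j)"
| "std_edge (Eval f) i j \<longleftrightarrow> rec_eval f (list_decode i) j"
| "std_edge (Args gs) i j \<longleftrightarrow> list_all2 (\<lambda>g. rec_eval g (list_decode i)) gs (list_decode j)"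
| "std_edge Pred i j \<longleftrightarrow> (\<exists>n xs. list_decode i = Suc n # xs \<and> list_decode j = n # xs)"
| "std_edge (Step (PrimRec f g)) i j \<longleftrightarrow> (\<exists>n xs y. list_decode i = Suc n # xs \<and>
    rec_eval (PrimRec f g) (n # xs) y \<and> list_decode j = n # y # xs)"
| "std_edge (Step _) i j \<longleftrightarrow> False"
| "std_edge (Search f) i j \<longleftrightarrow> (\<exists>n. list_decode j = n # list_decode i \<and>
    (\<forall>m<n. \<exists>k. rec_eval f (m # list_decode i) (Suc k)))"

text \<open>The intended model, shared by all programs. \<open>Hub\<close> relates all pairs of
  nodes, so any node can serve as root.\<close>

definition std_graph :: data_graph where
  "std_graph = {RoleAtom (edge_name k) (Indiv i) (Indiv j) | k i j. std_edge k i j}"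

lemma std_graph_iff [simp]:
  "RoleAtom (edge_name k) (Indiv i) (Indiv j) \<in> std_graph \<longleftrightarrow> std_edge k i j"
  by (auto simp: std_graph_def)

lemma ex_individual: "(\<exists>v. P v) \<longleftrightarrow> (\<exists>n. P (Indiv n))"
  by (metis individual.exhaust)

lemma all_individual: "(\<forall>v. P v) \<longleftrightarrow> (\<forall>n. P (Indiv n))"
  by (metis individual.exhaust)

lemma nodes_std_graph [simp]: "nodes std_graph = UNIV"
proof -
  have "u \<in> nodes std_graph" for u
  proof (cases u)
    case (Indiv i)
    have "RoleAtom (edge_name Hub) (Indiv i) (Indiv i) \<in> std_graph" by simp
    then show ?thesis unfolding nodes_def Indiv by (rule UN_I) simp
  qed
  then show ?thesis by auto
qed

lemma num_node_std_graph: "num_node std_graph n (Indiv i) \<longleftrightarrow> i = n"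
  by (induction n arbitrary: i) (auto simp: ex_individual)

lemma list_decode_eq_Nil [simp]: "list_decode n = [] \<longleftrightarrow> n = 0"
  by (metis list_decode.simps(1) list_decode_inverse)

lemma holds_proj_std_graph:
  "holds std_graph V ((Dia Tail ^^ i) (Dia Head (Lab LX))) (Indiv n) \<longleftrightarrow>
    i < length (list_decode n) \<and> Indiv (list_decode n ! i) \<in> V LX"
proof (induction i arbitrary: n)
  case 0
  then show ?case by (cases "list_decode n") (auto simp: ex_individual)
next
  case (Suc i)
  show ?case
  proof (cases "list_decode n")
    case (Cons x xs)
    then show ?thesis
      using Suc.IH[of "list_encode xs"]
      by (auto simp: ex_individual Suc.IH) (metis list_encode_inverse)
  qed (auto simp: ex_individual)
qed

lemma list_decode_eq_iff: "list_decode n = xs \<longleftrightarrow> n = list_encode xs"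
  by (metis list_decode_inverse list_encode_inverse)

lemma holds_Dia_std_graph [simp]:
  "holds std_graph V (Dia k q) (Indiv i) \<longleftrightarrow> (\<exists>j. std_edge k i j \<and> holds std_graph V q (Indiv j))"
  by (simp add: ex_individual)

lemma holds_DiaInv_std_graph [simp]:
  "holds std_graph V (DiaInv k q) (Indiv i) \<longleftrightarrow> (\<exists>j. std_edge k j i \<and> holds std_graph V q (Indiv j))"
  by (simp add: ex_individual)

text \<open>From here on diamonds are unfolded through \<open>std_edge\<close> on codes, and codes
  of lists stay folded so that decoding cancels them.\<close>

declare holds.simps(3,4) [simp del] list_encode.simps [simp del] list_encode_eq [simp]

lemma listed_std_graph: "V Root \<noteq> {} \<Longrightarrow> holds std_graph V listed (Indiv i)"
  by (simp add: ex_individual flip: ex_in_conv)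

lemma Dia_std_graphI:
  "std_edge k i j \<Longrightarrow> holds std_graph V q (Indiv j) \<Longrightarrow> holds std_graph V (Dia k q) (Indiv i)"
  by auto

lemma cons_query_std_graphI:
  assumes "V Root \<noteq> {}" "holds std_graph V p (Indiv x)" "holds std_graph V q (Indiv (list_encode xs))"
  shows "holds std_graph V (cons_query p q) (Indiv (list_encode (x # xs)))"
  using listed_std_graph[of V "list_encode (x # xs)"] assms
    Dia_std_graphI[of Head "list_encode (x # xs)" x]
    Dia_std_graphI[of Tail "list_encode (x # xs)" "list_encode xs"]
  by simp

lemma valid_std_graphI:
  assumes "\<And>V n. V Origin = {origin} \<Longrightarrow> a \<in> V Root \<Longrightarrow> holds std_graph V b (Indiv n) \<Longrightarrow>
    holds std_graph V h (Indiv n)"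
  shows "valid std_graph I a (b, h)"
  using assms by (simp add: valid_def all_individual)

text \<open>Each rule states a closure property of true evaluation, and a list demanded by a head
  exists as its code. Validity covers arbitrary label sets, not just singletons, because a supported
  model may choose any.\<close>

lemma valid_std_graph:
  "r \<in> set (rules f) \<Longrightarrow> valid std_graph I a r"
  "r \<in> set (arg_rules gs) \<Longrightarrow> valid std_graph I a r"
proof (induction f and gs arbitrary: r and r rule: rules_arg_rules.induct)
  case 1
  then show ?case
    by (auto intro!: valid_std_graphI rec_eval.zero)
next
  case 2
  then show ?case
    by (auto intro!: valid_std_graphI simp: list_decode_eq_iff) (blast intro: rec_eval.succ)
next
  case (3 i)
  then show ?case
    by (auto intro!: valid_std_graphI simp: holds_proj_std_graph) (blast intro: rec_eval.proj)
next
  case (4 f gs)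
  have "valid std_graph I a (Dia (Args gs) (Dia (Eval f) (Lab LX)), Dia (Eval (Comp f gs)) (Lab LX))"
    by (auto intro!: valid_std_graphI) (blast intro: rec_eval.comp)
  with 4 show ?case by (cases r) auto
next
  case (5 f g)
  let ?p = "PrimRec f g"
  have "valid std_graph I a (Conj (Dia Head (Lab Origin)) (Dia Tail (Dia (Eval f) (Lab LX))),
      Dia (Eval ?p) (Lab LX))"
    by (auto intro!: valid_std_graphI) (blast intro: rec_eval.primrec_0)
  moreover have "valid std_graph I a (Conj (Dia Head (DiaInv SuccOf (Lab LX))) (Dia Tail (Lab LY)),
      Dia Pred (cons_query (Lab LX) (Lab LY)))"
  proof (rule valid_std_graphI, goal_cases)
    case (1 V n)
    then obtain x k where "list_decode n = Suc x # list_decode k" "Indiv x \<in> V LX" "Indiv k \<in> V LY"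
      by auto
    with 1 show ?case
      by - (intro Dia_std_graphI[where j = "list_encode (x # list_decode k)"]
          cons_query_std_graphI; auto simp: less_Suc_eq)
  qed
  moreover have "valid std_graph I a (Conj (Dia Head (DiaInv SuccOf (Lab LX)))
        (Conj (Dia Tail (Lab LY)) (Dia Pred (Dia (Eval ?p) (Lab LZ)))),
      Dia (Step ?p) (cons_query (Lab LX) (cons_query (Lab LZ) (Lab LY))))"
  proof (rule valid_std_graphI, goal_cases)
    case (1 V n)
    then obtain x k y where "list_decode n = Suc x # list_decode k" "Indiv x \<in> V LX" "Indiv k \<in> V LY"
      "rec_eval ?p (x # list_decode k) y" "Indiv y \<in> V LZ"
      by auto
    with 1 show ?case
      by - (intro Dia_std_graphI[where j = "list_encode (x # y # list_decode k)"]
          cons_query_std_graphI; auto simp: less_Suc_eq)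
  qed
  moreover have "valid std_graph I a
      (Dia (Step ?p) (Dia (Eval g) (Lab LX)), Dia (Eval ?p) (Lab LX))"
    by (auto intro!: valid_std_graphI) (blast intro: rec_eval.primrec_Suc)
  ultimately show ?case using 5 by (cases r) auto
next
  case (6 f)
  have "valid std_graph I a (Lab LX, Dia (Search f) (cons_query (Lab Origin) (Lab LX)))"
  proof (rule valid_std_graphI, goal_cases)
    case (1 V n)
    then show ?case
      by - (intro Dia_std_graphI[where j = "list_encode (0 # list_decode n)"]
          cons_query_std_graphI; auto simp: less_Suc_eq)
  qed
  moreover have "valid std_graph I a (Conj (Lab LX)
        (Dia (Search f) (Conj (Dia Head (Lab LY)) (Dia (Eval f) (DiaInv SuccOf (Lab LZ))))),
      Dia (Search f) (cons_query (DiaInv SuccOf (Lab LY)) (Lab LX)))"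
  proof (rule valid_std_graphI, goal_cases)
    case (1 V n)
    then obtain m k where "Indiv n \<in> V LX" "\<forall>i<m. \<exists>k. rec_eval f (i # list_decode n) (Suc k)"
      "Indiv m \<in> V LY" "rec_eval f (m # list_decode n) (Suc k)"
      by auto
    with 1 show ?case
      by - (intro Dia_std_graphI[where j = "list_encode (Suc m # list_decode n)"]
          cons_query_std_graphI; auto simp: less_Suc_eq)
  qed
  moreover have "valid std_graph I a
      (Dia (Search f) (Conj (Dia Head (Lab LX)) (Dia (Eval f) (Lab Origin))),
       Dia (Eval (Mu f)) (Lab LX))"
    by (auto intro!: valid_std_graphI) (blast intro: rec_eval.mu)
  ultimately show ?case using 6 by (cases r) auto
next
  case 7
  then show ?case
    by (auto intro!: valid_std_graphI listed_std_graph simp del: holds_DiaInv_std_graph)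
next
  case (8 g gs)
  have "valid std_graph I a (Conj (Dia (Eval g) (Lab LX)) (Dia (Args gs) (Lab LY)),
     Dia (Args (g # gs)) (cons_query (Lab LX) (Lab LY)))"
  proof (rule valid_std_graphI, goal_cases)
    case (1 V n)
    then obtain y k where "rec_eval g (list_decode n) y" "Indiv y \<in> V LX"
      "list_all2 (\<lambda>g. rec_eval g (list_decode n)) gs (list_decode k)" "Indiv k \<in> V LY"
      by auto
    with 1 show ?case
      by - (intro Dia_std_graphI[where j = "list_encode (y # list_decode k)"]
          cons_query_std_graphI; auto simp: less_Suc_eq)
  qed
  with 8 show ?case by (cases r) auto
qed

section \<open>The constraint sets\<close>

text \<open>Supported models choose free shapes existentially, so what a shape can express is the
  failure of a rule: some labels make the body true and the head false.\<close>

definition rule_violation :: "rule \<Rightarrow> shape_expr" where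
  "rule_violation r = And (Shape (label_name Root))
    (Ex (Direct (edge_name Hub)) (And (pos_expr (fst r)) (neg_expr (snd r))))"

text \<open>If \<open>LX\<close> holds all nodes, the last disjunct asks for any outgoing
  \<open>Eval g\<close> edge. The shape thus fails only if some node for \<open>[n]\<close> lacks an
  \<open>Eval g\<close> edge into \<open>LX\<close>.\<close>

definition input_violation :: "recf \<Rightarrow> shape_expr" where
  "input_violation g = And (Shape (label_name Root)) (All (Direct (edge_name Hub))
    (Or (neg_expr (cons_query (Lab Input) nil_query))
      (Ex (Direct (edge_name (Eval g))) (Shape (label_name LX)))))"

definition violation :: "recf \<Rightarrow> shape_expr" where
  "violation g = foldr (\<lambda>r. Or (rule_violation r)) (rules g) (input_violation g)"

fun num_expr :: "nat \<Rightarrow> shape_expr" where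
  "num_expr 0 = Nominal origin"
| "num_expr (Suc n) = Ex (Inverse (edge_name SuccOf)) (num_expr n)"

text \<open>The constraint \<open>s \<leftarrow> s\<close> merely keeps \<open>s\<close> inside the
  graph, but it makes \<open>s\<close> defined, as stratification demands before \<open>s\<close>
  may be negated.\<close>

definition free_constraints :: "shape_constraint set" where
  "free_constraints = (\<lambda>l. (label_name l, Shape (label_name l))) ` {Root, LX, LY, LZ}"

text \<open>Independent of the input, so that the code of this set can itself become the
  input.\<close>

definition program_constraints :: "recf \<Rightarrow> shape_constraint set" where
  "program_constraints g = free_constraints \<union>
    {(label_name Origin, Nominal origin), (goal_name, violation g)}"

definition input_constraint :: "nat \<Rightarrow> shape_constraint" where
  "input_constraint n = (label_name Input, num_expr n)"

definition halting_constraints :: "recf \<Rightarrow> nat \<Rightarrow> shape_constraint set" where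
  "halting_constraints g n = insert (input_constraint n) (program_constraints g)"

definition halting_instance :: "recf \<Rightarrow> nat \<Rightarrow> implication_instance" where
  "halting_instance g n = ({}, halting_constraints g n, SName 0, goal_name)"

section \<open>Evaluation of the shapes in a graph\<close>

lemma role_atom_nodes:
  "RoleAtom p u v \<in> G \<Longrightarrow> u \<in> nodes G"
  "RoleAtom p u v \<in> G \<Longrightarrow> v \<in> nodes G"
  by (force simp: nodes_def)+

definition total_labels :: "data_graph \<Rightarrow> shape_literal set \<Rightarrow> bool" where
  "total_labels G S \<longleftrightarrow> (\<forall>l. \<forall>u\<in>nodes G.
    NegLit (label_name l) u \<in> S \<longleftrightarrow> PosLit (label_name l) u \<notin> S)"

definition label_sets :: "shape_literal set \<Rightarrow> label \<Rightarrow> individual set" where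
  "label_sets S l = {u. PosLit (label_name l) u \<in> S}"

lemma shape_eval_query:
  assumes "total_labels G S" "u \<in> nodes G"
  shows "u \<in> shape_eval G S (pos_expr q) \<longleftrightarrow> holds G (label_sets S) q u"
    and "u \<in> shape_eval G S (neg_expr q) \<longleftrightarrow> \<not> holds G (label_sets S) q u"
proof -
  have "(u \<in> shape_eval G S (pos_expr q) \<longleftrightarrow> holds G (label_sets S) q u) \<and>
    (u \<in> shape_eval G S (neg_expr q) \<longleftrightarrow> \<not> holds G (label_sets S) q u)"
    using assms(2)
  proof (induction q arbitrary: u)
    case (Lab l)
    with assms(1) show ?case by (simp add: total_labels_def label_sets_def)
  next
    case (Conj p q)
    then show ?case by simp
  next
    case (Dia k q)
    then show ?case by (auto simp: holds.simps(3,4) dest: role_atom_nodes)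
  next
    case (DiaInv k q)
    then show ?case by (auto simp: holds.simps(3,4) dest: role_atom_nodes)
  qed
  then show "u \<in> shape_eval G S (pos_expr q) \<longleftrightarrow> holds G (label_sets S) q u"
    and "u \<in> shape_eval G S (neg_expr q) \<longleftrightarrow> \<not> holds G (label_sets S) q u"
    by simp_all
qed

lemma shape_eval_num_expr: "shape_eval G S (num_expr n) = Collect (num_node G n)"
  by (induction n) (auto dest: role_atom_nodes)

lemma shape_eval_rule_violation:
  assumes "total_labels G S" "a \<in> nodes G"
  shows "a \<in> shape_eval G S (rule_violation r) \<longleftrightarrow> a \<in> label_sets S Root \<and>
    (\<exists>u. RoleAtom (edge_name Hub) a u \<in> G \<and>
      holds G (label_sets S) (fst r) u \<and> \<not> holds G (label_sets S) (snd r) u)"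
  using assms
  by (auto simp: rule_violation_def shape_eval_query role_atom_nodes label_sets_def)

lemma shape_eval_input_violation:
  assumes "total_labels G S" "a \<in> nodes G"
  shows "a \<in> shape_eval G S (input_violation g) \<longleftrightarrow> a \<in> label_sets S Root \<and>
    (\<forall>u. RoleAtom (edge_name Hub) a u \<in> G \<longrightarrow>
      holds G (label_sets S) (cons_query (Lab Input) nil_query) u \<longrightarrow>
      holds G (label_sets S) (Dia (Eval g) (Lab LX)) u)"
proof -
  have "u \<in> shape_eval G S (Or (neg_expr (cons_query (Lab Input) nil_query))
      (Ex (Direct (edge_name (Eval g))) (Shape (label_name LX)))) \<longleftrightarrow>
    (holds G (label_sets S) (cons_query (Lab Input) nil_query) u \<longrightarrow>
      holds G (label_sets S) (Dia (Eval g) (Lab LX)) u)"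
    if "RoleAtom (edge_name Hub) a u \<in> G" for u
    using shape_eval_query(2)[OF assms(1), of u "cons_query (Lab Input) nil_query"]
      shape_eval_query(1)[OF assms(1), of u "Dia (Eval g) (Lab LX)"] role_atom_nodes(2)[OF that]
    unfolding shape_eval.simps(6) pos_expr.simps by blast
  with assms(2) show ?thesis
    unfolding input_violation_def shape_eval.simps(5,7) by (auto simp: label_sets_def)
qed

lemma shape_eval_violation:
  "a \<in> shape_eval G S (violation g) \<longleftrightarrow>
    (\<exists>r\<in>set (rules g). a \<in> shape_eval G S (rule_violation r)) \<or>
    a \<in> shape_eval G S (input_violation g)"
proof -
  have "a \<in> shape_eval G S (foldr (\<lambda>r. Or (rule_violation r)) rs (input_violation g)) \<longleftrightarrow>
    (\<exists>r\<in>set rs. a \<in> shape_eval G S (rule_violation r)) \<or>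
    a \<in> shape_eval G S (input_violation g)" for rs
    by (induction rs) auto
  then show ?thesis by (simp add: violation_def)
qed

section \<open>Names occurring in the constraints, and their supported models\<close>

lemma label_name_eq [simp]: "label_name l = label_name l' \<longleftrightarrow> l = l'"
  by (cases l; cases l') auto

lemma label_name_neq_goal [simp]: "label_name l \<noteq> goal_name" "goal_name \<noteq> label_name l"
  by (cases l; simp)+

lemma expr_shapes_query:
  "expr_shapes (pos_expr q) \<subseteq> range label_name" "expr_shapes (neg_expr q) \<subseteq> range label_name"
  by (induction q) auto

lemma expr_shapes_violation: "expr_shapes (violation g) \<subseteq> range label_name"
proof -
  have "expr_shapes (foldr (\<lambda>r. Or (rule_violation r)) rs (input_violation g)) \<subseteq> range label_name"
    for rs
  proof (induction rs)
    case Nil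
    have "expr_shapes (input_violation g) \<subseteq> range label_name"
      unfolding input_violation_def expr_shapes.simps using expr_shapes_query by blast
    then show ?case by simp
  next
    case (Cons r rs)
    have "expr_shapes (rule_violation r) \<subseteq> range label_name"
      unfolding rule_violation_def expr_shapes.simps using expr_shapes_query by blast
    with Cons show ?case by simp
  qed
  then show ?thesis by (simp add: violation_def)
qed

lemma expr_shapes_num_expr [simp]: "expr_shapes (num_expr n) = {}"
  by (induction n) auto

lemma expr_neg_shapes_subset: "expr_neg_shapes \<phi> \<subseteq> expr_shapes \<phi>"
  by (induction \<phi>) auto

lemma expr_individuals_query [simp]:
  "expr_individuals (pos_expr q) = {}" "expr_individuals (neg_expr q) = {}"
  by (induction q) auto

lemma expr_individuals_violation: "expr_individuals (violation g) = {}"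
proof -
  have "expr_individuals (foldr (\<lambda>r. Or (rule_violation r)) rs (input_violation g)) = {}" for rs
    by (induction rs) (auto simp: rule_violation_def input_violation_def)
  then show ?thesis by (simp add: violation_def)
qed

lemma expr_individuals_num_expr [simp]: "expr_individuals (num_expr n) = {origin}"
  by (induction n) auto

lemma shape_names_halting_constraints:
  "shape_names (halting_constraints g n) = insert goal_name (range label_name)"
proof -
  have "UNIV = {Root, LX, LY, LZ, Origin, Input}"
    by (rule UNIV_eq_I, case_tac x) auto
  then have range: "range label_name = label_name ` {Root, LX, LY, LZ, Origin, Input}"
    by simp
  show ?thesis unfolding range
    using expr_shapes_violation[of g, unfolded range]
    by (auto simp: shape_names_def halting_constraints_def program_constraints_def
        input_constraint_def free_constraints_def)
qed

text \<open>An assignment may contain literals at individuals outside the graph, hence the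
  intersections with \<open>nodes G\<close>.\<close>

lemma supported_model_halting_constraints:
  "supported_model (halting_constraints g n) G S \<longleftrightarrow>
    shape_assignment S \<and> total_labels G S \<and>
    (\<forall>a\<in>nodes G. PosLit goal_name a \<in> S \<or> NegLit goal_name a \<in> S) \<and>
    (\<forall>l\<in>{Root, LX, LY, LZ}. label_sets S l \<subseteq> nodes G) \<and>
    label_sets S Origin \<inter> nodes G = {origin} \<and>
    label_sets S Input \<inter> nodes G = Collect (num_node G n) \<and>
    {a \<in> nodes G. PosLit goal_name a \<in> S} = shape_eval G S (violation g)"
  unfolding supported_model_def shape_names_halting_constraints
  by (auto simp: halting_constraints_def program_constraints_def input_constraint_def
      free_constraints_def total_labels_def label_sets_def shape_eval_num_expr
      shape_assignment_def)

section \<open>Definedness of the program is equivalent to the implication\<close>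

lemma holds_inter_nodes:
  "u \<in> nodes G \<Longrightarrow> holds G (\<lambda>l. V l \<inter> nodes G) q u \<longleftrightarrow> holds G V q u"
proof (induction q arbitrary: u)
  case (Dia k q)
  then show ?case by (auto simp: holds.simps(3,4) dest: role_atom_nodes)
next
  case (DiaInv k q)
  then show ?case by (auto simp: holds.simps(3,4) dest: role_atom_nodes)
qed auto

lemma shape_eval_cong:
  assumes "\<And>s u. s \<in> expr_shapes \<phi> \<Longrightarrow>
    (PosLit s u \<in> S \<longleftrightarrow> PosLit s u \<in> S') \<and> (NegLit s u \<in> S \<longleftrightarrow> NegLit s u \<in> S')"
  shows "shape_eval G S \<phi> = shape_eval G S' \<phi>"
  using assms by (induction \<phi>) auto

lemma satisfies_goal:
  assumes V: "V Origin = {origin}" "V Input = Collect (num_node G n)" "a \<in> V Root"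
    "\<And>l. V l \<subseteq> nodes G"
    and violated: "(\<exists>r\<in>set (rules g). \<exists>u. RoleAtom (edge_name Hub) a u \<in> G \<and>
        holds G V (fst r) u \<and> \<not> holds G V (snd r) u) \<or>
      (\<forall>u. RoleAtom (edge_name Hub) a u \<in> G \<longrightarrow> holds G V (cons_query (Lab Input) nil_query) u \<longrightarrow>
        holds G V (Dia (Eval g) (Lab LX)) u)"
  shows "satisfies_shape (halting_constraints g n) G a goal_name"
proof -
  define T where "T = {PosLit (label_name l) u | l u. u \<in> V l} \<union>
    {NegLit (label_name l) u | l u. u \<notin> V l}"
  \<comment> \<open>\<open>T\<close> settles the labels only. The goal does not occur in
    \<open>violation g\<close>, so adding its literals afterwards leaves this evaluation
    unchanged.\<close>
  define E where "E = shape_eval G T (violation g)"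
  define S where "S = T \<union> PosLit goal_name ` E \<union> NegLit goal_name ` (- E)"
  have S_label: "PosLit (label_name l) u \<in> S \<longleftrightarrow> u \<in> V l"
    "NegLit (label_name l) u \<in> S \<longleftrightarrow> u \<notin> V l" for l u
    by (auto simp: S_def T_def)
  have S_goal: "PosLit goal_name u \<in> S \<longleftrightarrow> u \<in> E" "NegLit goal_name u \<in> S \<longleftrightarrow> u \<notin> E" for u
    by (auto simp: S_def T_def)
  have sets: "label_sets S = V"
    by (auto simp: label_sets_def S_label)
  have total: "total_labels G S"
    by (simp add: total_labels_def S_label)
  have E: "shape_eval G S (violation g) = E"
    unfolding E_def
  proof (rule shape_eval_cong)
    fix s u
    assume "s \<in> expr_shapes (violation g)"
    then have "s \<noteq> goal_name" using expr_shapes_violation[of g] by auto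
    then show "(PosLit s u \<in> S \<longleftrightarrow> PosLit s u \<in> T) \<and> (NegLit s u \<in> S \<longleftrightarrow> NegLit s u \<in> T)"
      by (auto simp: S_def)
  qed
  have "E \<subseteq> nodes G"
    by (auto simp: E[symmetric] shape_eval_violation rule_violation_def input_violation_def)
  moreover have "shape_assignment S"
    by (auto simp: shape_assignment_def S_def T_def)
  ultimately have "supported_model (halting_constraints g n) G S"
    unfolding supported_model_halting_constraints sets E
    using V total V(4)[of Origin, unfolded V(1)] V(4)[of Input, unfolded V(2)] by (auto simp: S_goal)
  moreover have a: "a \<in> nodes G" using V(3) V(4)[of Root] by auto
  have "a \<in> E"
    using violated V(3) unfolding E[symmetric] shape_eval_violation
      shape_eval_rule_violation[OF total a] shape_eval_input_violation[OF total a] sets by auto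
  ultimately show ?thesis unfolding satisfies_shape_def using S_goal by blast
qed

lemma constraint_individuals_halting_constraints:
  "constraint_individuals (halting_constraints g n) = {origin}"
  by (auto simp: constraint_individuals_def halting_constraints_def program_constraints_def
      input_constraint_def free_constraints_def expr_individuals_violation)

text \<open>Either all rules are valid at \<open>a\<close>, and every node for \<open>[n]\<close>
  has its \<open>Eval g\<close> edge by \<open>eval_edge\<close>, or the labels refuting a rule give
  the supported model.\<close>

lemma implication_if_defined:
  assumes "rec_eval g [n] y"
  shows "shape_implication (halting_instance g n)"
proof -
  have "satisfies_shape (halting_constraints g n) G a goal_name"
    if "compatible G (halting_constraints g n)" and a: "a \<in> nodes G" for G a
  proof -
    have origin: "origin \<in> nodes G"
      using that by (simp add: compatible_def constraint_individuals_halting_constraints)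
    define I where "I = Collect (num_node G n)"
    have I: "I \<subseteq> nodes G"
      unfolding I_def using origin by (cases n) (auto dest: role_atom_nodes)
    show ?thesis
    proof (cases "\<forall>r\<in>set (rules g). valid G I a r")
      case True
      show ?thesis
      proof (rule satisfies_goal[where V = "val I a (nodes G) {} {}"])
        show "val I a (nodes G) {} {} l \<subseteq> nodes G" for l
          using a origin I by (cases l) auto
        have "holds G (val I a (nodes G) {} {}) (Dia (Eval g) (Lab LX)) u"
          if u: "RoleAtom (edge_name Hub) a u \<in> G"
            "holds G (val I a (nodes G) {} {}) (cons_query (Lab Input) nil_query) u" for u
        proof -
          have "list_node G a [n] u"
            using u by (auto simp: holds.simps(3,4) I_def)
          from eval_edge[OF assms True this] show ?thesis
            by (auto simp: holds.simps(3,4) dest: role_atom_nodes)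
        qed
        then show "(\<exists>r\<in>set (rules g). \<exists>u. RoleAtom (edge_name Hub) a u \<in> G \<and>
            holds G (val I a (nodes G) {} {}) (fst r) u \<and>
            \<not> holds G (val I a (nodes G) {} {}) (snd r) u) \<or>
          (\<forall>u. RoleAtom (edge_name Hub) a u \<in> G \<longrightarrow>
            holds G (val I a (nodes G) {} {}) (cons_query (Lab Input) nil_query) u \<longrightarrow>
            holds G (val I a (nodes G) {} {}) (Dia (Eval g) (Lab LX)) u)"
          by blast
      qed (simp_all add: I_def)
    next
      case False
      then obtain r V u where r: "r \<in> set (rules g)"
        and V: "V Origin = {origin}" "V Input = I" "a \<in> V Root"
        and u: "RoleAtom (edge_name Hub) a u \<in> G" "holds G V (fst r) u" "\<not> holds G V (snd r) u"
        by (auto simp: valid_def)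
      note inter = holds_inter_nodes[OF role_atom_nodes(2)[OF u(1)], of V]
      show ?thesis
      \<comment> \<open>\<open>valid\<close> quantifies over arbitrary sets of individuals, whereas
        the free constraints confine labels to nodes.\<close>
      proof (rule satisfies_goal[where V = "\<lambda>l. V l \<inter> nodes G"])
        show "(\<exists>r\<in>set (rules g). \<exists>u. RoleAtom (edge_name Hub) a u \<in> G \<and>
            holds G (\<lambda>l. V l \<inter> nodes G) (fst r) u \<and> \<not> holds G (\<lambda>l. V l \<inter> nodes G) (snd r) u) \<or>
          (\<forall>u. RoleAtom (edge_name Hub) a u \<in> G \<longrightarrow>
            holds G (\<lambda>l. V l \<inter> nodes G) (cons_query (Lab Input) nil_query) u \<longrightarrow>
            holds G (\<lambda>l. V l \<inter> nodes G) (Dia (Eval g) (Lab LX)) u)"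
          using r u inter by blast
      qed (use V a origin I in \<open>auto simp: I_def\<close>)
    qed
  qed
  then show ?thesis by (simp add: halting_instance_def)
qed

text \<open>In the standard graph no rule can be violated, and the node coding \<open>[n]\<close>
  has no \<open>Eval g\<close> edge at all, so neither disjunct of the goal can hold at
  \<open>origin\<close>.\<close>

lemma no_implication_if_undefined:
  assumes undefined: "\<And>y. \<not> rec_eval g [n] y"
  shows "\<not> shape_implication (halting_instance g n)"
proof
  assume "shape_implication (halting_instance g n)"
  moreover have "satisfies_shape {} std_graph origin (SName 0)"
    unfolding satisfies_shape_def
    by (rule exI[of _ "{PosLit (SName 0) origin}"])
      (auto simp: supported_model_def shape_assignment_def shape_names_def)
  ultimately have "satisfies_shape (halting_constraints g n) std_graph origin goal_name"
    by (auto simp: halting_instance_def compatible_def constraint_individuals_def)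
  then obtain S where S: "supported_model (halting_constraints g n) std_graph S"
    "PosLit goal_name origin \<in> S" by (auto simp: satisfies_shape_def)
  let ?V = "label_sets S"
  have total: "total_labels std_graph S"
    and V: "?V Origin = {origin}" "?V Input = {Indiv n}"
    and violated: "origin \<in> shape_eval std_graph S (violation g)"
    using S by (auto simp: supported_model_halting_constraints num_node_std_graph
        set_eq_iff all_individual)
  note eval = shape_eval_rule_violation[OF total] shape_eval_input_violation[OF total]
  have hub: "RoleAtom (edge_name Hub) origin u \<in> std_graph" for u
    by (cases u) simp
  show False
    using violated unfolding shape_eval_violation
  proof
    assume "\<exists>r\<in>set (rules g). origin \<in> shape_eval std_graph S (rule_violation r)"
    then obtain r u where r: "r \<in> set (rules g)" "origin \<in> ?V Root"
      "holds std_graph ?V (fst r) u" "\<not> holds std_graph ?V (snd r) u"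
      by (auto simp: eval)
    then show False
      using valid_std_graph(1)[OF r(1), of "{Indiv n}" origin] V hub[of u] by (auto simp: valid_def)
  next
    assume "origin \<in> shape_eval std_graph S (input_violation g)"
    then have "origin \<in> ?V Root" and
      *: "holds std_graph ?V (cons_query (Lab Input) nil_query) (Indiv (list_encode [n])) \<Longrightarrow>
        holds std_graph ?V (Dia (Eval g) (Lab LX)) (Indiv (list_encode [n]))"
      using hub by (auto simp: eval simp del: holds.simps)
    have "holds std_graph ?V (Dia (Eval g) (Lab LX)) (Indiv (list_encode [n]))"
      using \<open>origin \<in> ?V Root\<close> V
      by (intro * cons_query_std_graphI) (auto simp: list_encode.simps(1))
    then show False using undefined by auto
  qed
qed

section \<open>Computing the code of an instance\<close>

lemma label_name_in_Domain:
  "range label_name \<subseteq> Domain (insert (input_constraint n)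
    (insert (label_name Origin, Nominal origin) free_constraints))"
proof -
  have "label_name l \<in> Domain (insert (input_constraint n)
    (insert (label_name Origin, Nominal origin) free_constraints))" for l
    by (cases l) (auto simp: input_constraint_def free_constraints_def)
  then show ?thesis by auto
qed

lemma stratified_halting_constraints: "stratified (halting_constraints g n)"
  unfolding stratified_def
proof (intro exI conjI)
  let ?C = "insert (input_constraint n) (insert (label_name Origin, Nominal origin) free_constraints)"
  \<comment> \<open>The lower stratum holds the negation-free label constraints; the goal above it
    negates labels only.\<close>
  let ?P = "\<lambda>i::nat. if i = 0 then ?C else {(goal_name, violation g)}"
  have Suc_0: "{..Suc 0} = {0, Suc 0}" "{..<Suc 0} = {0}" by auto
  show "halting_constraints g n = (\<Union>i\<le>1. ?P i)"
    by (auto simp: halting_constraints_def program_constraints_def Suc_0)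
  show "disjoint_family_on ?P {..1}"
    by (auto simp: disjoint_family_on_def input_constraint_def free_constraints_def)
  have "(i < 1 \<longrightarrow> expr_shapes \<phi> \<subseteq> Domain (\<Union>j\<le>i. ?P j)) \<and>
      expr_neg_shapes \<phi> \<subseteq> Domain (\<Union>j<i. ?P j)"
    if "i \<le> 1" "(s, \<phi>) \<in> ?P i" for i s \<phi>
  proof (cases "i = 0")
    case True
    with that show ?thesis
      using expr_neg_shapes_subset[of "num_expr n"]
      by (auto simp: input_constraint_def free_constraints_def)
  next
    case False
    with that have "i = Suc 0" "\<phi> = violation g" by auto
    moreover have "expr_neg_shapes (violation g) \<subseteq> Domain ?C"
      using expr_neg_shapes_subset expr_shapes_violation label_name_in_Domain
      by (rule order_trans[OF order_trans])
    ultimately show ?thesis by (simp add: Suc_0)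
  qed
  then show "\<forall>i\<le>1. \<forall>(s, \<phi>)\<in>?P i. (i < 1 \<longrightarrow> expr_shapes \<phi> \<subseteq> Domain (\<Union>j\<le>i. ?P j)) \<and>
      expr_neg_shapes \<phi> \<subseteq> Domain (\<Union>j<i. ?P j)"
    by (intro allI impI ballI, unfold split_def) (metis prod.collapse)
qed

lemma halting_instance_stratified: "halting_instance g n \<in> stratified_implication_instances"
proof -
  have "constraint_set (halting_constraints g n)"
    by (auto simp: constraint_set_def single_valued_def halting_constraints_def
        program_constraints_def free_constraints_def input_constraint_def)
  moreover have "stratified {}"
    unfolding stratified_def
    by (intro exI[of _ 0] exI[of _ "\<lambda>_. {}"]) (auto simp: disjoint_family_on_def)
  ultimately show ?thesis
    by (simp add: stratified_implication_instances_def halting_instance_def constraint_set_def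
        stratified_halting_constraints)
qed

text \<open>Inserting a new constraint adds one power of two to the code of the set, so only
  arithmetic in \<open>n\<close> remains once the code of the program is known. The constants are
  the code of \<open>{}\<close> and the indices of \<open>Input\<close>, \<open>SName 0\<close> and
  the goal.\<close>

lemma instance_code_halting_instance:
  "instance_code (halting_instance g n) =
    prod_encode (prod_encode (0, constraint_set_code (program_constraints g) +
      2 ^ prod_encode (1, expr_code (num_expr n))), prod_encode (0, 6))"
proof -
  have "finite (program_constraints g)"
    by (simp add: program_constraints_def free_constraints_def)
  moreover have "input_constraint n \<notin> program_constraints g"
    by (auto simp: program_constraints_def free_constraints_def input_constraint_def)
  ultimately have "constraint_set_code (halting_constraints g n) =
      constraint_set_code (program_constraints g) + 2 ^ constraint_code (input_constraint n)"
    unfolding constraint_set_code_def halting_constraints_def image_insert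
    by (subst set_encode_insert) (auto simp: constraint_code_inject)
  moreover have "constraint_set_code {} = 0"
    by (simp add: constraint_set_code_def)
  ultimately show ?thesis
    by (simp add: halting_instance_def input_constraint_def constraint_code_def)
qed

section \<open>Recursive functions for the arithmetic of the encoding\<close>

lemma rec_eval_Comp1:
  "rec_eval g xs y \<Longrightarrow> rec_eval f [y] z \<Longrightarrow> rec_eval (Comp f [g]) xs z"
  by (rule rec_eval.comp[of _ _ "[y]"]) auto

lemma rec_eval_Comp2:
  "rec_eval g xs y \<Longrightarrow> rec_eval h xs y' \<Longrightarrow> rec_eval f [y, y'] z \<Longrightarrow> rec_eval (Comp f [g, h]) xs z"
  by (rule rec_eval.comp[of _ _ "[y, y']"]) auto

lemma rec_eval_Proj_0: "rec_eval (Proj 0) (x # xs) x"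
  using rec_eval.proj[of 0 "x # xs"] by simp

lemma rec_eval_Proj_1: "rec_eval (Proj 1) (x # y # xs) y"
  using rec_eval.proj[of 1 "x # y # xs"] by simp

fun const_recf :: "nat \<Rightarrow> recf" where
  "const_recf 0 = Zero"
| "const_recf (Suc c) = Comp Succ [const_recf c]"

lemma rec_eval_const: "rec_eval (const_recf c) xs c"
  by (induction c) (simp_all add: rec_eval.zero rec_eval_Comp1[OF _ rec_eval.succ])

text \<open>In the step function of \<open>PrimRec\<close>, \<open>Proj 0\<close> is the counter and
  \<open>Proj 1\<close> the previous value.\<close>

definition add_recf :: recf where
  "add_recf = PrimRec (Proj 0) (Comp Succ [Proj 1])"

lemma rec_eval_add: "rec_eval add_recf [x, y] (x + y)"
  unfolding add_recf_def
proof (induction x)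
  case 0
  show ?case unfolding add_0 by (rule rec_eval.primrec_0 rec_eval_Proj_0)+
next
  case (Suc x)
  show ?case
    unfolding add_Suc
    by (rule rec_eval.primrec_Suc[OF Suc.IH])
      (rule rec_eval_Comp1 rec_eval_Proj_1 rec_eval.succ)+
qed

definition triangle_recf :: recf where
  "triangle_recf = PrimRec Zero (Comp add_recf [Proj 1, Comp Succ [Proj 0]])"

lemma rec_eval_triangle: "rec_eval triangle_recf [x] (triangle x)"
  unfolding triangle_recf_def
proof (induction x)
  case 0
  show ?case unfolding triangle_0 by (rule rec_eval.primrec_0 rec_eval.zero)+
next
  case (Suc x)
  show ?case
    unfolding triangle_Suc
    by (rule rec_eval.primrec_Suc[OF Suc.IH])
      (rule rec_eval_Comp2 rec_eval_Comp1 rec_eval_Proj_0 rec_eval_Proj_1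
        rec_eval.succ rec_eval_add)+
qed

definition pair_recf :: recf where
  "pair_recf = Comp add_recf [Comp triangle_recf [add_recf], Proj 0]"

lemma rec_eval_pair: "rec_eval pair_recf [x, y] (prod_encode (x, y))"
  unfolding pair_recf_def prod_encode_def prod.case
  by (rule rec_eval_Comp2 rec_eval_Comp1 rec_eval_add rec_eval_triangle rec_eval_Proj_0)+

definition pow2_recf :: recf where
  "pow2_recf = PrimRec (const_recf 1) (Comp add_recf [Proj 1, Proj 1])"

lemma rec_eval_pow2: "rec_eval pow2_recf [x] (2 ^ x)"
  unfolding pow2_recf_def
proof (induction x)
  case 0
  show ?case unfolding power_0 by (rule rec_eval.primrec_0 rec_eval_const)+
next
  case (Suc x)
  have "rec_eval (Comp add_recf [Proj 1, Proj 1]) [x, 2 ^ x] (2 ^ Suc x)"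
    unfolding power_Suc mult_2
    by (rule rec_eval_Comp2 rec_eval_Proj_1 rec_eval_add)+
  with Suc show ?case by (rule rec_eval.primrec_Suc)
qed

text \<open>The constant 7 is the tag of \<open>Ex\<close> in \<open>expr_code\<close>.\<close>

definition num_expr_recf :: recf where
  "num_expr_recf = PrimRec (const_recf (expr_code (Nominal origin)))
    (Comp pair_recf [const_recf 7,
      Comp pair_recf [const_recf (role_code (Inverse (edge_name SuccOf))), Proj 1]])"

lemma rec_eval_num_expr: "rec_eval num_expr_recf [n] (expr_code (num_expr n))"
  unfolding num_expr_recf_def
proof (induction n)
  case 0
  show ?case unfolding num_expr.simps by (rule rec_eval.primrec_0 rec_eval_const)+
next
  case (Suc n)
  show ?case
    unfolding num_expr.simps(2) expr_code.simps(8)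
    by (rule rec_eval.primrec_Suc[OF Suc.IH])
      (rule rec_eval_Comp2 rec_eval_const rec_eval_Proj_1 rec_eval_pair)+
qed

definition instance_recf :: recf where
  "instance_recf = Comp pair_recf
    [Comp pair_recf [const_recf 0,
      Comp add_recf [Proj 0, Comp pow2_recf [Comp pair_recf [const_recf 1, num_expr_recf]]]],
     const_recf (prod_encode (0, 6))]"

text \<open>The single argument plays two parts: code of the program constraints and number
  described by the input constraint.\<close>

lemma rec_eval_instance:
  assumes "n = constraint_set_code (program_constraints g)"
  shows "rec_eval instance_recf [n] (instance_code (halting_instance g n))"
  unfolding instance_recf_def instance_code_halting_instance assms[symmetric]
  by (rule rec_eval_Comp2 rec_eval_Comp1 rec_eval_const rec_eval_Proj_0 rec_eval_pair
      rec_eval_add rec_eval_pow2 rec_eval_num_expr)+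

text \<open>Diagonalisation. Since a decision procedure has to be correct on \<open>D\<close> only,
  one argument for all \<open>D\<close> containing the stratified instances settles both
  variants.\<close>

lemma undecidable_if_stratified:
  assumes "stratified_implication_instances \<subseteq> D"
  shows "\<not> decidable_problem instance_code D shape_implication"
proof
  assume "decidable_problem instance_code D shape_implication"
  then obtain f where f: "\<And>x. x \<in> D \<Longrightarrow>
      rec_eval f [instance_code x] (if shape_implication x then 1 else 0)"
    unfolding decidable_problem_def by blast
  \<comment> \<open>\<open>h\<close> ignores the search variable, so \<open>Mu h\<close> stops at
    once if \<open>f\<close> answers 0 and never if \<open>f\<close> answers 1.\<close>
  define h where "h = Comp f [Comp instance_recf [Proj 1]]"
  define g where "g = Mu h"
  define n where "n = constraint_set_code (program_constraints g)"
  define x where "x = halting_instance g n"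
  have "x \<in> D"
    using assms halting_instance_stratified unfolding x_def by blast
  then have h: "rec_eval h [m, n] (if shape_implication x then 1 else 0)" for m
    unfolding h_def
    using rec_eval_instance[OF n_def] unfolding x_def[symmetric]
    by (blast intro: rec_eval_Comp1 rec_eval_Proj_1 f)
  show False
  proof (cases "shape_implication x")
    case True
    then obtain y where "rec_eval g [n] y"
      unfolding x_def using no_implication_if_undefined by blast
    then have "rec_eval h [y, n] 0"
      unfolding g_def by (auto elim: rec_eval_MuE)
    with h[of y] True show False by (auto dest: rec_eval_unique)
  next
    case False
    with h[of 0] have "rec_eval g [n] 0"
      unfolding g_def by (auto intro: rec_eval.mu)
    with False show False
      unfolding x_def using implication_if_defined by blast
  qed
qed

theorem theorem1:
  "\<not> decidable_problem instance_code implication_instances shape_implication \<and>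
   \<not> decidable_problem instance_code stratified_implication_instances shape_implication"
  by (intro conjI undecidable_if_stratified)
    (auto simp: stratified_implication_instances_def implication_instances_def)

end
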